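(* Let $\Lambda=a\mathbb{Z}^{1/2}\times b\mathbb{Z}^{1/2}\subset\mathbb{R}^2$, where $a,b>0$. If $a<1$ or $b<1$, then $\Lambda$ does Gabor phase retrieval. Moreover, if $a=b>1$, then $\Lambda$ does not do Gabor phase retrieval.
   Context: Let $\varphi(x)=e^{-\pi x^2}$, $x\in\mathbb{R}$. For $f\in L^2(\mathbb{R})$ the Gabor transform is $V_\varphi f(t,\omega)=\int_{\mathbb{R}} f(x)\varphi(x-t)e^{-2\pi i x\omega}\,dx$, $(t,\omega)\in\mathbb{R}^2$. A set $\Lambda\subset\mathbb{R}^2$ does Gabor phase retrieval if, for all $f_1,f_2\in L^2(\mathbb{R})$, the condition $|V_\varphi f_1(t,\omega)|=|V_\varphi f_2(t,\omega)|$ for all $(t,\omega)\in\Lambda$ implies that there is a real constant $\alpha$ with $f_1=e^{i\alpha}f_2$ almost everywhere. $\mathbb{Z}^{1/2}:=\{\pm n^{1/2}: n\ge 0,\ n\in\mathbb{Z}\}$ and $a\mathbb{Z}^{1/2}=\{a\lambda:\lambda\in\mathbb{Z}^{1/2}\}$. *)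

theory Defs
  imports "HOL-Analysis.Analysis"
begin

text \<open>Elements of $L^2(\mathbb{R})$ are represented by complex-valued Lebesgue measurable,
  square-integrable functions; equality in $L^2$ is equality almost everywhere.\<close>

definition L2 :: "(real \<Rightarrow> complex) set" where
  "L2 = {f \<in> borel_measurable lebesgue. integrable lebesgue (\<lambda>x. (cmod (f x))\<^sup>2)}"

definition gauss :: "real \<Rightarrow> real" where
  "gauss x = exp (- pi * x\<^sup>2)"

definition gabor_transform :: "(real \<Rightarrow> complex) \<Rightarrow> real \<Rightarrow> real \<Rightarrow> complex" where
  "gabor_transform f t \<omega> =
    (LINT x|lebesgue. f x * of_real (gauss (x - t)) * exp (- 2 * pi * \<i> * x * \<omega>))"

definition does_gabor_phase_retrieval :: "(real \<times> real) set \<Rightarrow> bool" where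
  "does_gabor_phase_retrieval \<Lambda> \<longleftrightarrow>
    (\<forall>f1\<in>L2. \<forall>f2\<in>L2.
      (\<forall>(t, \<omega>)\<in>\<Lambda>. cmod (gabor_transform f1 t \<omega>) = cmod (gabor_transform f2 t \<omega>)) \<longrightarrow>
      (\<exists>\<alpha>::real. AE x in lebesgue. f1 x = exp (\<i> * \<alpha>) * f2 x))"

definition sqrt_ints :: "real set" where
  "sqrt_ints = {sqrt (real n) | n::nat. True} \<union> {- sqrt (real n) | n::nat. True}"

end

theory Submission
  imports Defs "HOL-Complex_Analysis.Complex_Analysis" "HOL-Probability.Levy" "HOL-Real_Asymp.Real_Asymp"
begin

text \<open>Let \<open>F\<close> be the Bargmann transform of \<open>f\<close>, so that \<open>\<bar>F z\<bar> \<le> C * exp (pi / 2 * \<bar>z\<bar>\<^sup>2)\<close> and, up to a Gaussian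
  weight, the spectrogram is \<open>F (t + \<i> * \<omega>) * F\<^sup>* (t - \<i> * \<omega>)\<close> with \<open>F\<^sup>* z = cnj (F (cnj z))\<close>. For fixed real
  \<open>\<omega>\<close> this is entire in \<open>t\<close> and bounded by a multiple of \<open>exp (pi * \<bar>t\<bar>\<^sup>2)\<close>. If the spectrograms of two
  signals agree at \<open>t = a * sqrt n\<close> with \<open>a < 1\<close>, their difference, viewed as a function of \<open>t\<^sup>2 / a\<^sup>2\<close>,
  has exponential type less than \<open>pi\<close> and vanishes at the natural numbers, so it is zero by
  Carlson's theorem. Hence \<open>\<bar>F1\<bar> = \<bar>F2\<bar>\<close> on all lines \<open>Im z = b * sqrt n\<close>. Reflecting in consecutive
  lines makes \<open>F1 / F2\<close> periodic with arbitrarily small periods, hence constant. The case \<open>b < 1\<close>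
  is the same after a rotation by a quarter turn.

  For \<open>a = b > 1\<close> the functions \<open>exp (\<i> * \<gamma> * z\<^sup>2) \<plusminus> \<i> * exp (- \<i> * \<gamma> * z\<^sup>2)\<close> with \<open>\<gamma> = pi / (2 * a\<^sup>2) < pi / 2\<close>
  are Bargmann transforms of combinations of two conjugate chirped Gaussians, and they have equal
  moduli wherever \<open>(Re (z\<^sup>2)) / a\<^sup>2\<close> is an integer.\<close>

section \<open>Carlson's theorem\<close>

text \<open>At a zero of \<open>d\<close> the value of \<open>h\<close> is the quotient of the
  derivatives, which is its limit there. Simple zeros are isolated, so this continuity already
  removes the singularity.\<close>

lemma holomorphic_quotient_simple_zeros:
  assumes A: "open A" and g: "g holomorphic_on A" and d: "d holomorphic_on A"
    and z: "\<And>z. z \<in> A \<Longrightarrow> d z = 0 \<Longrightarrow> g z = 0 \<and> deriv d z \<noteq> 0"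
  obtains h where "h holomorphic_on A" "\<And>z. z \<in> A \<Longrightarrow> g z = h z * d z"
proof
  define h where "h = (\<lambda>z. if d z = 0 then deriv g z / deriv d z else g z / d z)"
  show "g z = h z * d z" if "z \<in> A" for z
    using z[OF that] by (auto simp: h_def)
  have "h field_differentiable (at p)" if p: "p \<in> A" for p
  proof -
    have contd: "isCont d p" and contg: "isCont g p"
      using holomorphic_on_imp_continuous_on[OF d] holomorphic_on_imp_continuous_on[OF g] A p
      by (simp_all add: continuous_on_eq_continuous_at)
    have ev_d: "(d has_field_derivative deriv d p) (at p)" and ev_g: "(g has_field_derivative deriv g p) (at p)"
      using d g A p by (auto intro: holomorphic_derivI)
    show ?thesis
    proof (cases "d p = 0")
      case False
      have "\<forall>\<^sub>F z in nhds p. d z \<noteq> 0"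
        using contd False unfolding continuous_at tendsto_at_iff_tendsto_nhds by (rule tendsto_imp_eventually_ne)
      then have "\<forall>\<^sub>F z in nhds p. g z / d z = h z"
        by eventually_elim (auto simp: h_def)
      moreover have "((\<lambda>z. g z / d z) has_field_derivative (deriv g p * d p - g p * deriv d p) / (d p * d p)) (at p)"
        using DERIV_divide[OF ev_g ev_d False] .
      ultimately have "(h has_field_derivative (deriv g p * d p - g p * deriv d p) / (d p * d p)) (at p)"
        by (subst (asm) DERIV_cong_ev[OF refl _ refl])
      then show ?thesis
        unfolding field_differentiable_def by blast
    next
      case True
      with z p have gp: "g p = 0" and dp: "deriv d p \<noteq> 0" by auto
      have lim: "((\<lambda>z. ((g z - g p) / (z - p)) / ((d z - d p) / (z - p))) \<longlongrightarrow> deriv g p / deriv d p) (at p)"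
        using ev_d ev_g dp by (intro tendsto_divide) (auto simp: has_field_derivative_iff)
      have lim': "((\<lambda>z. (d z - d p) / (z - p)) \<longlongrightarrow> deriv d p) (at p)"
        using ev_d by (auto simp: has_field_derivative_iff)
      have "\<forall>\<^sub>F z in at p. (d z - d p) / (z - p) \<noteq> 0"
        using tendsto_imp_eventually_ne[OF lim' dp] .
      then have ne: "\<forall>\<^sub>F z in at p. d z \<noteq> 0"
        by (rule eventually_mono) (use True in auto)
      have hlim: "(h \<longlongrightarrow> h p) (at p)"
      proof (rule Lim_transform_eventually)
        show "((\<lambda>z. ((g z - g p) / (z - p)) / ((d z - d p) / (z - p))) \<longlongrightarrow> h p) (at p)"
        proof -
          have "h p = deriv g p / deriv d p" using True by (simp add: h_def)
          with lim show ?thesis by (simp only:)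
        qed
        show "\<forall>\<^sub>F z in at p. ((g z - g p) / (z - p)) / ((d z - d p) / (z - p)) = h z"
          using ne eventually_neq_at_within[of p p UNIV] by eventually_elim (use True gp in \<open>auto simp: h_def\<close>)
      qed
      have "\<forall>\<^sub>F z in at p. z \<in> A" 
        using A p by (intro eventually_at_in_open')
      from eventually_conj[OF ne this] obtain r where r: "r > 0" "\<And>z. z \<noteq> p \<Longrightarrow> dist z p < r \<Longrightarrow> d z \<noteq> 0 \<and> z \<in> A"
        unfolding eventually_at by auto
      have hol: "h holomorphic_on ball p r - {p}"
      proof -
        have "(\<lambda>z. g z / d z) holomorphic_on ball p r - {p}"
          using r by (intro holomorphic_intros holomorphic_on_subset[OF g] holomorphic_on_subset[OF d]) (force simp: dist_commute)+
        then show ?thesis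
          by (rule holomorphic_transform) (use r in \<open>auto simp: h_def dist_commute\<close>)
      qed
      have "continuous_on (ball p r) h"
      proof -
        have "isCont h z" if "z \<in> ball p r" for z
        proof (cases "z = p")
          case True then show ?thesis using hlim by (simp add: isCont_def)
        next
          case False
          then have "z \<in> ball p r - {p}" using that by auto
          then show ?thesis using holomorphic_on_imp_continuous_on[OF hol]
            by (simp add: continuous_on_eq_continuous_at open_delete)
        qed
        then show ?thesis by (simp add: continuous_at_imp_continuous_on)
      qed
      then have "h holomorphic_on ball p r"
        using hol by (rule no_isolated_singularity) auto
      then show ?thesis
        using r(1) by (simp add: holomorphic_on_open field_differentiable_def)
    qed
  qed
  then show "h holomorphic_on A"
    by (simp add: holomorphic_on_def field_differentiable_at_within)
qed

text \<open>\<open>|cos w|^2\<close> equals \<open>cos^2 (Re w) + sinh^2 (Im w)\<close>. The first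
  alternative turns this into \<open>cosh^2 (Im w)\<close>; under the second the \<open>sinh\<close>
  term alone suffices.\<close>

lemma norm_cos_ge:
  fixes w :: complex
  assumes "(cos (Re w))\<^sup>2 = 1 \<or> \<bar>Im w\<bar> \<ge> 1"
  shows "exp \<bar>Im w\<bar> / 4 \<le> cmod (cos w)"
proof -
  define E where "E = exp \<bar>Im w\<bar>"
  have E1: "E \<ge> 1" by (simp add: E_def)
  have eq: "(exp (Im w) - inverse (exp (Im w)))\<^sup>2 = (E - 1 / E)\<^sup>2"
    by (auto simp: E_def abs_if exp_minus field_simps power2_commute)
  have "(E / 4)\<^sup>2 \<le> (cos (Re w))\<^sup>2 + (E - 1 / E)\<^sup>2 / 4"
  proof (cases "\<bar>Im w\<bar> \<ge> 1")
    case True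
    have "2 \<le> exp (1::real)" using exp_ge_add_one_self[of 1] by simp
    also have "\<dots> \<le> E" using True by (simp add: E_def)
    finally have "E \<ge> 2" .
    then have "E * E \<ge> 2 * 2" by (intro mult_mono) auto
    then have "E / 2 \<le> E - 1 / E" using \<open>E \<ge> 2\<close> by (simp add: field_simps)
    then have "(E / 2)\<^sup>2 \<le> (E - 1 / E)\<^sup>2" using E1 by (intro power_mono) auto
    moreover have "(E / 4)\<^sup>2 = (E / 2)\<^sup>2 / 4" by (simp add: power2_eq_square)
    ultimately show ?thesis using zero_le_power2[of "cos (Re w)"] by linarith
  next
    case False
    then have "(cos (Re w))\<^sup>2 + (E - 1 / E)\<^sup>2 / 4 = ((E + 1 / E) / 2)\<^sup>2"
      using assms E1 by (auto simp: power2_eq_square field_simps)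
    moreover have "E / 4 \<le> (E + 1 / E) / 2" using E1 by (simp add: field_simps)
    then have "(E / 4)\<^sup>2 \<le> ((E + 1 / E) / 2)\<^sup>2" using E1 by (intro power_mono) auto
    ultimately show ?thesis by simp
  qed
  then have "(E / 4)\<^sup>2 \<le> (cmod (cos w))\<^sup>2"
    unfolding norm_cos_squared eq .
  then show ?thesis
    unfolding E_def by (rule power2_le_imp_le) auto
qed

text \<open>Carlson's theorem, shifted by one half: the divisor \<open>cos (pi * s)\<close> then has no zero on the
  boundary of the half-plane. Instead of the usual passage through sectors, the quotient is
  multiplied by \<open>exp (M * s - \<delta> * (s + 1) * Ln (s + 1))\<close>: the second term beats every
  exponential inside the half-plane and loses only \<open>exp (\<delta> * pi / 2 * \<bar>Im s\<bar>)\<close> near the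
  imaginary axis, which the cosine absorbs. So the bound is uniform in \<open>M\<close>.\<close>

lemma carlson_half_integers:
  fixes g :: "complex \<Rightarrow> complex"
  assumes hol: "g holomorphic_on {s. Re s > -1/2}"
    and zero: "\<And>n::nat. g (of_nat n + 1/2) = 0"
    and bound: "\<And>s. Re s \<ge> 0 \<Longrightarrow> cmod (g s) \<le> C * exp (c * cmod s)"
    and c: "0 \<le> c" "c < pi"
    and s0: "Re s0 > 0"
  shows "g s0 = 0"
proof -
  let ?A = "{s::complex. Re s > -1/2}"
  have opA: "open ?A" by (rule open_halfspace_Re_gt)
  have derivcos: "((\<lambda>s. cos (of_real pi * s)) has_field_derivative - sin (of_real pi * z) * of_real pi) (at z)" for z :: complex
    by (auto intro!: derivative_eq_intros)
  obtain h where h: "h holomorphic_on ?A" "\<And>z. z \<in> ?A \<Longrightarrow> g z = h z * cos (of_real pi * z)"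
  proof (rule holomorphic_quotient_simple_zeros[OF opA hol])
    show "(\<lambda>s. cos (of_real pi * s)) holomorphic_on ?A"
      by (intro holomorphic_intros)
    \<comment> \<open>The zeros of the cosine are the points \<open>n + 1/2\<close>;
      \<open>Re z > -1/2\<close> leaves only \<open>n \<ge> 0\<close>, where \<open>g\<close>
      vanishes.\<close>
    show "g z = 0 \<and> deriv (\<lambda>s. cos (of_real pi * s)) z \<noteq> 0" if z: "z \<in> ?A" "cos (of_real pi * z) = 0" for z
    proof -
      obtain n :: int where "of_real pi * z = of_real (of_int n * pi) + of_real pi / 2"
        using z(2) unfolding cos_eq_0 by blast
      then have "of_real pi * z = of_real pi * (of_int n + 1 / 2)"
        by (simp add: algebra_simps)
      then have zn: "z = of_int n + 1 / 2"
        by (subst (asm) mult_cancel_left) simp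
      then have "n \<ge> 0" using z by simp
      then obtain m :: nat where "n = int m"
        by (metis nonneg_int_cases)
      then have "g z = 0" using zero zn by simp
      moreover have "sin (of_real pi * z) \<noteq> 0"
        using z(2) sin_cos_squared_add[of "of_real pi * z"] by force
      ultimately show ?thesis
        using DERIV_imp_deriv[OF derivcos] by simp
    qed
  qed auto
  \<comment> \<open>Chosen so that \<open>\<delta> * pi / 2 = pi - c\<close>, the decay that
    \<open>1 / cos\<close> has to spare in the vertical direction over the growth of
    \<open>g\<close>.\<close>
  define \<delta> where "\<delta> = 2 * (pi - c) / pi"
  have \<delta>: "\<delta> > 0" using c by (simp add: \<delta>_def)
  define R where "R = Re ((s0 + 1) * Ln (s0 + 1))"
  have C: "C \<ge> 0"
    using bound[of 0] order_trans[OF norm_ge_zero] by force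
  \<comment> \<open>Only the last factor depends on \<open>M\<close>; letting \<open>M\<close> tend
    to infinity will force \<open>h s0 = 0\<close>.\<close>
  have main: "cmod (h s0) \<le> 4 * C * exp (\<delta> * R) * exp (- (M * Re s0))" if M: "M \<ge> 0" for M
  proof -
    define k where "k = (\<lambda>s. h s * exp (of_real M * s - of_real \<delta> * ((s + 1) * Ln (s + 1))))"
    \<comment> \<open>This puts \<open>s0\<close> into the box and makes
      \<open>ln |s + 1| \<ge> (c + M) / \<delta>\<close> at all boundary points off the imaginary
      axis.\<close>
    obtain N :: nat where N: "real N \<ge> 1 + \<bar>Re s0\<bar> + \<bar>Im s0\<bar> + exp ((c + M) / \<delta>)"
      using real_arch_simple by blast
    define S where "S = cbox (Complex 0 (- real N)) (Complex (real N) (real N))"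
    have SA: "S \<subseteq> ?A" by (auto simp: S_def in_cbox_complex_iff)
    have norm_exp: "cmod (exp (of_real M * s - of_real \<delta> * ((s + 1) * Ln (s + 1)))) =
          exp (M * Re s - \<delta> * Re ((s + 1) * Ln (s + 1)))" for s
      by (simp add: norm_exp_eq_Re)
    have holk: "k holomorphic_on ?A"
      unfolding k_def by (intro holomorphic_intros h) (auto simp: complex_nonpos_Reals_iff)
    have frontier: "cmod (k s) \<le> 4 * C" if s: "s \<in> frontier S" for s
    proof -
      have sS: "s \<in> S" and sbd: "Re s = 0 \<or> Re s = real N \<or> \<bar>Im s\<bar> = real N"
        using s by (auto simp: S_def frontier_cbox in_cbox_complex_iff in_box_complex_iff)
      have x: "Re s \<ge> 0" "Re s \<le> real N" "\<bar>Im s\<bar> \<le> real N"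
        using sS by (auto simp: S_def in_cbox_complex_iff)
      have N1: "real N \<ge> 1" using N exp_ge_zero[of "(c + M) / \<delta>"] by linarith
      \<comment> \<open>On the vertical sides \<open>Re s\<close> is the integer \<open>0\<close> or
        \<open>N\<close>, so the squared cosine is \<open>1\<close>; on the horizontal sides the
        imaginary part is at least \<open>1\<close>.\<close>
      have "(cos (Re (of_real pi * s)))\<^sup>2 = 1 \<or> \<bar>Im (of_real pi * s)\<bar> \<ge> 1"
      proof (cases "\<bar>Im s\<bar> = real N")
        case True
        have "1 * 1 \<le> pi * \<bar>Im s\<bar>" using True N1 pi_gt3 by (intro mult_mono) auto
        then show ?thesis by (simp add: abs_mult)
      next
        case False
        then have "Re s = 0 \<or> Re s = real N" using sbd by auto
        then show ?thesis
          by (auto simp: mult.commute[of pi] simp flip: power_mult)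
      qed
      then have cos_ge: "exp (pi * \<bar>Im s\<bar>) / 4 \<le> cmod (cos (of_real pi * s))"
        using norm_cos_ge[of "of_real pi * s"] by (simp add: abs_mult)
      have "cmod (h s) * cmod (cos (of_real pi * s)) \<le> C * exp (c * cmod s)"
        using h(2)[of s] sS SA bound[OF x(1)] by (auto simp: norm_mult)
      also have "\<dots> \<le> C * exp (c * (Re s + \<bar>Im s\<bar>))"
        using C c x(1) cmod_le[of s] by (auto intro!: mult_left_mono)
      finally have "cmod (h s) * (exp (pi * \<bar>Im s\<bar>) / 4) \<le> C * exp (c * (Re s + \<bar>Im s\<bar>))"
        using mult_left_mono[OF cos_ge norm_ge_zero[of "h s"]] by linarith
      then have "cmod (h s) \<le> 4 * C * (exp (c * (Re s + \<bar>Im s\<bar>)) / exp (pi * \<bar>Im s\<bar>))"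
        by (simp add: field_simps)
      then have hs: "cmod (h s) \<le> 4 * C * exp (c * (Re s + \<bar>Im s\<bar>) - pi * \<bar>Im s\<bar>)"
        by (simp add: exp_diff)
      define L where "L = ln (cmod (s + 1))"
      have w: "cmod (s + 1) \<ge> 1" "s + 1 \<noteq> 0" "Re (s + 1) > 0"
        using x complex_Re_le_cmod[of "s + 1"] by (auto simp: complex_eq_iff)
      then have L0: "L \<ge> 0" by (simp add: L_def)
      have cML: "(c + M) * Re s \<le> \<delta> * (Re s + 1) * L"
      proof (cases "Re s = 0")
        case True then show ?thesis using L0 \<delta> by simp
      next
        case False
        then have "cmod (s + 1) \<ge> real N"
          using sbd abs_Re_le_cmod[of "s + 1"] abs_Im_le_cmod[of "s + 1"] x by auto
        then have "exp ((c + M) / \<delta>) \<le> cmod (s + 1)" using N by linarith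
        then have "(c + M) / \<delta> \<le> L" using w unfolding L_def by (subst ln_ge_iff) auto
        then have "c + M \<le> \<delta> * L" using \<delta> by (simp add: field_simps)
        then have "(c + M) * Re s \<le> \<delta> * L * (Re s + 1)"
          using x c M by (intro mult_mono) auto
        then show ?thesis by (simp add: algebra_simps)
      qed
      have "Re ((s + 1) * Ln (s + 1)) = (Re s + 1) * L - Im s * Im (Ln (s + 1))"
        using w by (simp add: L_def)
      moreover have "\<bar>Im s * Im (Ln (s + 1))\<bar> \<le> \<bar>Im s\<bar> * (pi / 2)"
        using Re_Ln_pos_lt[OF w(2)] w(3) unfolding abs_mult by (intro mult_left_mono) auto
      ultimately have "Re ((s + 1) * Ln (s + 1)) \<ge> (Re s + 1) * L - \<bar>Im s\<bar> * (pi / 2)"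
        by linarith
      then have "\<delta> * ((Re s + 1) * L - \<bar>Im s\<bar> * (pi / 2)) \<le> \<delta> * Re ((s + 1) * Ln (s + 1))"
        by (rule mult_left_mono) (use \<delta> in auto)
      moreover have "\<delta> * (\<bar>Im s\<bar> * (pi / 2)) = (pi - c) * \<bar>Im s\<bar>"
        by (simp add: \<delta>_def)
      ultimately have "\<delta> * Re ((s + 1) * Ln (s + 1)) \<ge> \<delta> * (Re s + 1) * L - (pi - c) * \<bar>Im s\<bar>"
        unfolding right_diff_distrib by (simp only: mult.assoc)
      with cML have ex: "c * (Re s + \<bar>Im s\<bar>) - pi * \<bar>Im s\<bar> + (M * Re s - \<delta> * Re ((s + 1) * Ln (s + 1))) \<le> 0"
        unfolding distrib_left distrib_right left_diff_distrib by linarith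
      have "cmod (k s) = cmod (h s) * exp (M * Re s - \<delta> * Re ((s + 1) * Ln (s + 1)))"
        unfolding k_def norm_mult norm_exp ..
      also have "\<dots> \<le> 4 * C * exp (c * (Re s + \<bar>Im s\<bar>) - pi * \<bar>Im s\<bar>) * exp (M * Re s - \<delta> * Re ((s + 1) * Ln (s + 1)))"
        using hs by (intro mult_right_mono) auto
      also have "\<dots> = 4 * C * exp (c * (Re s + \<bar>Im s\<bar>) - pi * \<bar>Im s\<bar> + (M * Re s - \<delta> * Re ((s + 1) * Ln (s + 1))))"
        by (simp only: exp_add mult.assoc)
      also have "\<dots> \<le> 4 * C * 1"
        using C ex by (intro mult_left_mono) auto
      finally show ?thesis by simp
    qed
    have "cmod (k s0) \<le> 4 * C"
    proof (rule maximum_modulus_frontier[of k S])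
      show "k holomorphic_on interior S"
        using holk SA interior_subset by (rule_tac holomorphic_on_subset) blast+
      show "continuous_on (closure S) k"
        using holomorphic_on_imp_continuous_on[OF holk] SA unfolding S_def
        by (auto intro: continuous_on_subset)
      show "bounded S" by (simp add: S_def)
      have "Re s0 \<le> real N" "\<bar>Im s0\<bar> \<le> real N"
        using N exp_ge_zero[of "(c + M) / \<delta>"] by linarith+
      then show "s0 \<in> S" using s0 unfolding S_def in_cbox_complex_iff by auto
    qed (use frontier in auto)
    then have "cmod (h s0) * (exp (M * Re s0) / exp (\<delta> * R)) \<le> 4 * C"
      unfolding k_def norm_mult norm_exp by (simp add: R_def exp_diff)
    then show ?thesis by (simp add: field_simps exp_minus)
  qed
  have "((\<lambda>M. 4 * C * exp (\<delta> * R) * exp (- (M * Re s0))) \<longlongrightarrow> 0) at_top"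
    using s0 by real_asymp
  then have "cmod (h s0) \<le> 0"
    by (rule tendsto_lowerbound) (use main in \<open>auto simp: eventually_at_top_linorder\<close>)
  then show ?thesis using h(2)[of s0] s0 by simp
qed

section \<open>Entire functions with equal moduli on a lattice of square roots\<close>

text \<open>With \<open>z = a * sqrt (s + 1/2)\<close>, growth of order two in \<open>z\<close>
  becomes exponential type \<open>pi * a^2 < pi\<close> in \<open>s\<close>, and the zeros
  \<open>a * sqrt (n + 1)\<close> land on \<open>s = n + 1/2\<close>. The identity theorem carries
  the vanishing from the image of the half-plane to the whole plane.\<close>

lemma entire_zero_on_sqrt_multiples:
  fixes D :: "complex \<Rightarrow> complex"
  assumes hol: "D holomorphic_on UNIV"
    and zero: "\<And>n::nat. D (of_real (a * sqrt (real n))) = 0"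
    and bound: "\<And>z. cmod (D z) \<le> C * exp (pi * (cmod z)\<^sup>2)"
    and a: "0 < a" "a < 1"
  shows "D z = 0"
proof -
  define g where "g = (\<lambda>s. D (of_real a * csqrt (s + 1/2)))"
  have g0: "g s = 0" if "Re s > 0" for s
  proof (rule carlson_half_integers[of g _ _ s, OF _ _ _ _ _ that])
    have "(\<lambda>s. of_real a * csqrt (s + 1/2)) holomorphic_on {s. Re s > -1/2}"
      by (intro holomorphic_intros) (auto simp: complex_nonpos_Reals_iff)
    from holomorphic_on_compose[OF this holomorphic_on_subset[OF hol]]
    show "g holomorphic_on {s. Re s > -1/2}" by (simp add: g_def o_def)
    show "g (of_nat n + 1/2) = 0" for n
    proof -
      have "of_nat n + 1/2 + 1/2 = complex_of_real (real (Suc n))" by simp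
      then have "csqrt (of_nat n + 1/2 + 1/2) = of_real (sqrt (real (Suc n)))"
        by (simp only: csqrt_of_real_nonneg Re_complex_of_real Im_complex_of_real of_nat_0_le_iff)
      then show ?thesis using zero[of "Suc n"] by (simp add: g_def)
    qed
    show "cmod (g s) \<le> C * exp (pi * a\<^sup>2 / 2) * exp (pi * a\<^sup>2 * cmod s)" for s
    proof -
      have C: "C \<ge> 0" using order_trans[OF norm_ge_zero bound[of 0]] by simp
      have "(cmod (of_real a * csqrt (s + 1/2)))\<^sup>2 = a\<^sup>2 * cmod ((csqrt (s + 1/2))\<^sup>2)"
        unfolding norm_mult power_mult_distrib norm_power by simp
      then have "(cmod (of_real a * csqrt (s + 1/2)))\<^sup>2 = a\<^sup>2 * cmod (s + 1/2)"
        by simp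
      then have "cmod (g s) \<le> C * exp (pi * (a\<^sup>2 * cmod (s + 1/2)))"
        using bound[of "of_real a * csqrt (s + 1/2)"] by (simp add: g_def)
      also have "\<dots> \<le> C * exp (pi * (a\<^sup>2 * (cmod s + 1/2)))"
        using C norm_triangle_ineq[of s "1/2"] by (auto intro!: mult_left_mono)
      also have "\<dots> = C * exp (pi * a\<^sup>2 / 2) * exp (pi * a\<^sup>2 * cmod s)"
        by (simp add: algebra_simps flip: exp_add)
      finally show ?thesis .
    qed
    show "0 \<le> pi * a\<^sup>2" "pi * a\<^sup>2 < pi"
      using a by (auto simp: power_less_one_iff abs_square_less_1)
  qed
  \<comment> \<open>The image of \<open>Re s > 0\<close> under
    \<open>s \<mapsto> a * csqrt (s + 1/2)\<close>.\<close>
  define U where "U = {z. Re z > 0 \<and> Re ((z / of_real a)\<^sup>2 - 1/2) > 0}"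
  have "open U" unfolding U_def
    by (intro open_Collect_conj open_Collect_less continuous_intros) (use a in auto)
  moreover have "of_real a \<in> U" using a by (simp add: U_def)
  moreover have "D z = 0" if "z \<in> U" for z
  proof -
    have "csqrt ((z / of_real a)\<^sup>2) = z / of_real a"
      using that a by (intro csqrt_square) (auto simp: U_def Re_divide_of_real)
    then show ?thesis
      using g0[of "(z / of_real a)\<^sup>2 - 1/2"] that a by (simp add: g_def U_def)
  qed
  ultimately show ?thesis
    using analytic_continuation_open[of U UNIV D "\<lambda>_. 0" z] hol by auto
qed

text \<open>Cancellation of a nonzero factor: \<open>g\<close> vanishes on the nonempty open set
  where \<open>f\<close> does not, hence everywhere.\<close>

lemma entire_mult_eq_0:
  fixes f g :: "complex \<Rightarrow> complex"
  assumes f: "f holomorphic_on UNIV" and g: "g holomorphic_on UNIV"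
    and fg: "\<And>z. f z * g z = 0" and z: "f z0 \<noteq> 0"
  shows "g w = 0"
proof -
  have "open (f -` (- {0}))"
    using holomorphic_on_imp_continuous_on[OF f] by (intro open_vimage) auto
  then show ?thesis
    using analytic_continuation_open[of "f -` (- {0})" UNIV g "\<lambda>_. 0" w] g fg z by auto
qed

lemma entire_cnj_cnj:
  assumes "f holomorphic_on UNIV"
  shows "(\<lambda>z. cnj (f (cnj z))) holomorphic_on UNIV"
  using holomorphic_on_compose_cnj_cnj[OF holomorphic_on_subset[OF assms], of UNIV] by (simp add: o_def)

lemma entire_shift:
  assumes "f holomorphic_on UNIV"
  shows "(\<lambda>z. f (z + w)) holomorphic_on UNIV"
proof -
  have "(\<lambda>z. z + w) holomorphic_on UNIV" by (intro holomorphic_intros)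
  from holomorphic_on_compose_gen[OF this assms] show ?thesis by (simp add: o_def)
qed

text \<open>Equality of moduli on the line \<open>Im z = \<omega>\<close> reads \<open>F1 z * G1 w = F2 z * G2 w\<close> for
  \<open>w = z - 2 * \<i> * \<omega>\<close> and \<open>G z = cnj (F (cnj z))\<close>. Two consecutive lines share the point \<open>w\<close>;
  eliminating it shows that \<open>F1 / F2\<close> has period \<open>\<delta> n = 2 * \<i> * b * (sqrt (n + 1) - sqrt n)\<close>, and these
  periods tend to \<open>0\<close>.\<close>

lemma entire_eq_up_to_phase:
  fixes F1 F2 :: "complex \<Rightarrow> complex"
  assumes hol: "F1 holomorphic_on UNIV" "F2 holomorphic_on UNIV"
    and bound: "\<And>z. cmod (F1 z) \<le> C1 * exp (pi / 2 * (cmod z)\<^sup>2)"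
               "\<And>z. cmod (F2 z) \<le> C2 * exp (pi / 2 * (cmod z)\<^sup>2)"
    and eq: "\<And>m n :: nat. cmod (F1 (Complex (a * sqrt (real m)) (b * sqrt (real n)))) =
                          cmod (F2 (Complex (a * sqrt (real m)) (b * sqrt (real n))))"
    and ab: "0 < a" "a < 1" "0 < b"
  shows "\<exists>c. cmod c = 1 \<and> (\<forall>z. F1 z = c * F2 z)"
proof -
  define G1 where "G1 = (\<lambda>z. cnj (F1 (cnj z)))"
  define G2 where "G2 = (\<lambda>z. cnj (F2 (cnj z)))"
  have holG: "G1 holomorphic_on UNIV" "G2 holomorphic_on UNIV"
    using hol by (auto simp: G1_def G2_def intro: entire_cnj_cnj)
  define \<omega> where "\<omega> = (\<lambda>n::nat. \<i> * of_real (b * sqrt (real n)))"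
  \<comment> \<open>By the parallelogram law the squared moduli of \<open>t + \<i> y\<close> and
    \<open>t - \<i> y\<close> add up to \<open>2 |t|^2 + 2 y^2\<close>, so the product grows like
    \<open>exp (pi |t|^2)\<close> only.\<close>
  have prod_bound: "cmod (f (t + \<i> * of_real y) * cnj (f (cnj (t + - (\<i> * of_real y))))) \<le> c\<^sup>2 * exp (pi * y\<^sup>2) * exp (pi * (cmod t)\<^sup>2)"
    if "\<And>z. cmod (f z) \<le> c * exp (pi / 2 * (cmod z)\<^sup>2)" for f c t y
  proof -
    have "cmod (f (t + \<i> * of_real y) * cnj (f (cnj (t + - (\<i> * of_real y))))) \<le>
        (c * exp (pi / 2 * (cmod (t + \<i> * of_real y))\<^sup>2)) * (c * exp (pi / 2 * (cmod (cnj (t + - (\<i> * of_real y))))\<^sup>2))"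
      unfolding norm_mult complex_mod_cnj[of "f _"] by (intro mult_mono that norm_ge_zero order_trans[OF norm_ge_zero that])
    also have "\<dots> = c\<^sup>2 * exp (pi / 2 * ((cmod (t + \<i> * of_real y))\<^sup>2 + (cmod (cnj (t + - (\<i> * of_real y))))\<^sup>2))"
      by (simp add: power2_eq_square distrib_left exp_add)
    also have "(cmod (t + \<i> * of_real y))\<^sup>2 + (cmod (cnj (t + - (\<i> * of_real y))))\<^sup>2 = 2 * y\<^sup>2 + 2 * (cmod t)\<^sup>2"
      unfolding cmod_power2 by (simp add: power2_eq_square algebra_simps)
    finally show ?thesis by (simp add: algebra_simps flip: exp_add)
  qed
  \<comment> \<open>For real \<open>t\<close> the two arguments are conjugate and this is equality
    of squared moduli; agreement at the points \<open>a * sqrt m\<close> extends it to complex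
    \<open>t\<close>.\<close>
  have lines: "F1 (t + \<omega> n) * G1 (t + - \<omega> n) = F2 (t + \<omega> n) * G2 (t + - \<omega> n)" for t n
  proof -
    define D where "D = (\<lambda>t. F1 (t + \<omega> n) * G1 (t + - \<omega> n) - F2 (t + \<omega> n) * G2 (t + - \<omega> n))"
    have "D t = 0"
    proof (rule entire_zero_on_sqrt_multiples[of D, OF _ _ _ ab(1,2)])
      show "D holomorphic_on UNIV" unfolding D_def
        by (intro holomorphic_intros entire_shift hol holG)
      show "D (of_real (a * sqrt (real m))) = 0" for m
      proof -
        define z where "z = Complex (a * sqrt (real m)) (b * sqrt (real n))"
        have z: "of_real (a * sqrt (real m)) + \<omega> n = z" "cnj (of_real (a * sqrt (real m)) + - \<omega> n) = z"
          by (auto simp: z_def \<omega>_def complex_eq_iff)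
        have "D (of_real (a * sqrt (real m))) = F1 z * cnj (F1 z) - F2 z * cnj (F2 z)"
          unfolding D_def G1_def G2_def z ..
        also have "\<dots> = 0"
          using eq[of m n] by (simp add: z_def complex_norm_square[symmetric])
        finally show ?thesis .
      qed
      show "cmod (D t) \<le> (C1\<^sup>2 + C2\<^sup>2) * exp (pi * (b * sqrt (real n))\<^sup>2) * exp (pi * (cmod t)\<^sup>2)" for t
        using norm_triangle_ineq4[of "F1 (t + \<omega> n) * G1 (t + - \<omega> n)" "F2 (t + \<omega> n) * G2 (t + - \<omega> n)"]
          prod_bound[OF bound(1), of t "b * sqrt (real n)"] prod_bound[OF bound(2), of t "b * sqrt (real n)"]
        unfolding D_def G1_def G2_def \<omega>_def distrib_right by linarith
    qed
    then show ?thesis by (simp add: D_def)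
  qed
  have lines0: "F1 t * G1 t = F2 t * G2 t" for t
    using lines[of t 0] by (simp add: \<omega>_def)
  show ?thesis
  proof (cases "(\<forall>z. F1 z = 0) \<or> (\<forall>z. F2 z = 0)")
    case True
    have "(\<forall>z. F1 z = 0) \<and> (\<forall>z. F2 z = 0)"
    proof (rule ccontr)
      assume neg: "\<not> ?thesis"
      have *: False if "f holomorphic_on UNIV" "\<And>t. f t * cnj (f (cnj t)) = 0" "f z \<noteq> 0" for f z
        using entire_mult_eq_0[OF that(1) entire_cnj_cnj[OF that(1)] that(2,3), of "cnj z"] that(3) by simp
      from True show False
      proof
        assume "\<forall>z. F1 z = 0"
        then show False
          using neg *[OF hol(2)] lines0 unfolding G2_def by auto
      next
        assume "\<forall>z. F2 z = 0"
        then show False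
          using neg *[OF hol(1)] lines0 unfolding G1_def by auto
      qed
    qed
    then show ?thesis by (intro exI[of _ 1]) auto
  next
    case False
    then obtain z1 z2 where z12: "F1 z1 \<noteq> 0" "F2 z2 \<noteq> 0" by blast
    define \<delta> where "\<delta> = (\<lambda>n. \<omega> (Suc n) + \<omega> (Suc n) - (\<omega> n + \<omega> n))"
    have step: "F1 z * F2 (z + \<delta> n) - F2 z * F1 (z + \<delta> n) = 0" for n z
    proof -
      define W where "W = (\<lambda>z. F1 z * F2 (z + \<delta> n) - F2 z * F1 (z + \<delta> n))"
      have W: "W holomorphic_on UNIV" unfolding W_def
        by (intro holomorphic_intros entire_shift hol)
      define v where "v = - (\<omega> n + \<omega> n)"
      \<comment> \<open>\<open>z\<close> and \<open>z + \<delta> n\<close> have the same mirror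
        image \<open>z + v\<close>, each in its own line. The two relations put the vector
        \<open>(G1, - G2)\<close> at \<open>z + v\<close> into the kernel of a matrix with
        determinant \<open>W z\<close>.\<close>
      have "G1 (z + v) * (G2 (z + v) * W z) = 0" for z
      proof -
        have "F1 z * G1 (z + v) = F2 z * G2 (z + v)"
          using lines[of "z - \<omega> n" n] by (simp add: v_def algebra_simps)
        moreover have "F1 (z + \<delta> n) * G1 (z + v) = F2 (z + \<delta> n) * G2 (z + v)"
          using lines[of "z + v + \<omega> (Suc n)" "Suc n"] by (simp add: v_def \<delta>_def algebra_simps)
        ultimately show ?thesis unfolding W_def by algebra
      qed
      moreover have "G1 (cnj z1 - v + v) \<noteq> 0" and G2: "G2 (cnj z2 - v + v) \<noteq> 0"
        using z12 by (auto simp: G1_def G2_def)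
      ultimately have "G2 (w + v) * W w = 0" for w
        using entire_mult_eq_0[OF entire_shift[OF holG(1)] holomorphic_on_mult[OF entire_shift[OF holG(2)] W]] by blast
      then have "W z = 0"
        using entire_mult_eq_0[OF entire_shift[OF holG(2)] W _ G2] by blast
      then show ?thesis by (simp add: W_def)
    qed
    have \<delta>_eq: "\<delta> n = \<i> * of_real (2 * b * (sqrt (real (Suc n)) - sqrt (real n)))" for n
      by (simp add: \<delta>_def \<omega>_def algebra_simps)
    have lim: "0 islimpt range \<delta>"
      unfolding islimpt_sequential
    proof (intro exI conjI allI)
      show "\<delta> n \<in> range \<delta> - {0}" for n using ab by (simp add: \<delta>_eq)
      have "(\<lambda>n. sqrt (real (Suc n)) - sqrt (real n)) \<longlonglongrightarrow> 0" by real_asymp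
      then have "\<delta> \<longlonglongrightarrow> \<i> * of_real (2 * b * 0)" unfolding \<delta>_eq[abs_def] by (intro tendsto_intros)
      then show "\<delta> \<longlonglongrightarrow> 0" by simp
    qed
    \<comment> \<open>As a function of the shift \<open>p\<close> the determinant is entire and
      vanishes at every \<open>\<delta> n\<close>; these accumulate at \<open>0\<close>, so it
      vanishes for all \<open>p\<close>, in particular for \<open>p = z2 - z\<close>.\<close>
    have cross: "F1 z * F2 z2 = F2 z * F1 z2" for z
    proof -
      have "F1 z * F2 (p + z) - F2 z * F1 (p + z) = 0" for p
      proof (rule analytic_continuation[of "\<lambda>p. F1 z * F2 (p + z) - F2 z * F1 (p + z)",
            OF _ open_UNIV connected_UNIV _ _ lim])
        show "(\<lambda>p. F1 z * F2 (p + z) - F2 z * F1 (p + z)) holomorphic_on UNIV"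
          by (intro holomorphic_intros entire_shift hol)
      qed (use step[of z] in \<open>auto simp: add.commute\<close>)
      from this[of "z2 - z"] show ?thesis by simp
    qed
    define c where "c = F1 z2 / F2 z2"
    have F1: "F1 z = c * F2 z" for z
      using cross[of z] z12 by (simp add: c_def field_simps)
    \<comment> \<open>The relation for the real line, with \<open>F1 = c * F2\<close> inserted,
      forces \<open>|c| = 1\<close>.\<close>
    have "F2 t * ((c * cnj c - 1) * G2 t) = 0" for t
      using lines0[of t] by (simp add: F1 G1_def G2_def algebra_simps)
    then have "(c * cnj c - 1) * G2 (cnj z2) = 0"
      by (intro entire_mult_eq_0[OF hol(2) _ _ z12(2), of "\<lambda>t. (c * cnj c - 1) * G2 t"] holomorphic_intros holG)
    then have "c * cnj c = 1" using z12 by (simp add: G2_def)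
    then have "complex_of_real ((cmod c)\<^sup>2) = of_real 1"
      unfolding complex_norm_square by simp
    then have "(cmod c)\<^sup>2 = 1\<^sup>2"
      unfolding of_real_eq_iff by simp
    then have "cmod c = 1"
      by (rule power2_eq_imp_eq) auto
    then show ?thesis using F1 by blast
  qed
qed

section \<open>Uniqueness for the Fourier transform\<close>

text \<open>The positive and negative parts have equal mass, by the case \<open>t = 0\<close>. If it
  is not zero, they normalise to probability densities with the same characteristic function, and
  Levy's uniqueness theorem identifies them.\<close>

lemma AE_eq_0_of_fourier_real:
  fixes r :: "real \<Rightarrow> real"
  assumes r: "integrable lborel r"
    and zero: "\<And>t. (CLINT x|lborel. of_real (r x) * iexp (t * x)) = 0"
  shows "AE x in lborel. r x = 0"
proof -
  define p where "p = (\<lambda>x. max 0 (r x))"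
  define q where "q = (\<lambda>x. max 0 (- r x))"
  have pq: "integrable lborel p" "integrable lborel q"
    using r by (auto simp: p_def q_def)
  have pq0: "p x \<ge> 0" "q x \<ge> 0" "r x = p x - q x" for x
    by (auto simp: p_def q_def)
  have cpq: "integrable lborel (\<lambda>x. of_real (f x) * iexp (t * x))" if "integrable lborel f" for f :: "real \<Rightarrow> real" and t
    by (rule Bochner_Integration.integrable_bound[OF that]) (use that in \<open>auto simp: norm_mult\<close>)
  have eq: "(CLINT x|lborel. of_real (p x) * iexp (t * x)) = (CLINT x|lborel. of_real (q x) * iexp (t * x))" for t
    using zero[of t] Bochner_Integration.integral_diff[OF cpq[OF pq(1)] cpq[OF pq(2)], of t t]
    by (simp add: pq0(3) algebra_simps)
  define m where "m = (LINT x|lborel. p x)"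
  have mq: "m = (LINT x|lborel. q x)"
    using eq[of 0] by (simp add: m_def)
  have m0: "m \<ge> 0" by (simp add: m_def pq0)
  show ?thesis
  proof (cases "m = 0")
    case True
    then have "AE x in lborel. p x = 0" "AE x in lborel. q x = 0"
      using integral_nonneg_eq_0_iff_AE[OF pq(1)] integral_nonneg_eq_0_iff_AE[OF pq(2)] pq0
      by (auto simp: m_def mq[unfolded m_def])
    then show ?thesis by eventually_elim (simp add: pq0(3))
  next
    case False
    with m0 have m: "m > 0" by simp
    define M where "M = (\<lambda>f::real \<Rightarrow> real. density lborel (\<lambda>x. ennreal (f x / m)))"
    have dist: "real_distribution (M f)"
      if "integrable lborel f" "\<And>x. f x \<ge> 0" "m = (LINT x|lborel. f x)" for f
    proof -
      have "(\<integral>\<^sup>+x. ennreal (f x / m) \<partial>lborel) = 1"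
        using that m by (subst nn_integral_eq_integral) auto
      then have "prob_space (M f)"
        using that(1) by (intro prob_spaceI) (auto simp: M_def emeasure_density)
      then show ?thesis
        by (auto simp: real_distribution_def real_distribution_axioms_def M_def)
    qed
    have char: "char (M f) t = (CLINT x|lborel. of_real (f x) * iexp (t * x)) / of_real m"
      if "integrable lborel f" "\<And>x. f x \<ge> 0" for f t
    proof -
      have "char (M f) t = (CLINT x|lborel. (f x / m) *\<^sub>R iexp (t * x))"
        unfolding char_def M_def using that m by (subst integral_density) auto
      also have "\<dots> = (CLINT x|lborel. (of_real (f x) * iexp (t * x)) / of_real m)"
        by (intro Bochner_Integration.integral_cong) (auto simp: scaleR_conv_of_real)
      finally show ?thesis by simp
    qed
    have "M p = M q"
      by (rule Levy_uniqueness) (use dist char pq pq0 mq eq in \<open>auto simp: m_def\<close>)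
    then have "AE x in lborel. ennreal (p x / m) = ennreal (q x / m)"
      using pq unfolding M_def by (intro sigma_finite_measure.density_unique[OF sigma_finite_lborel]) auto
    then show ?thesis
      by eventually_elim (use pq0 m in auto)
  qed
qed

text \<open>Conjugation swaps the frequencies \<open>t\<close> and \<open>- t\<close>, so
  \<open>cnj g\<close> has zero transform too, and with it the real and imaginary parts.\<close>

lemma AE_eq_0_of_fourier:
  fixes g :: "real \<Rightarrow> complex"
  assumes g: "integrable lebesgue g"
    and zero: "\<And>t. (CLINT x|lebesgue. g x * iexp (t * x)) = 0"
  shows "AE x in lebesgue. g x = 0"
proof -
  have iexp_meas: "(\<lambda>x. iexp (t * x)) \<in> borel_measurable lebesgue" for t :: real
    by (rule measurable_completion) simp
  have real: "AE x in lebesgue. r x = 0"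
    if r: "integrable lebesgue r" and z: "\<And>t. (CLINT x|lebesgue. of_real (r x) * iexp (t * x)) = 0"
    for r :: "real \<Rightarrow> real"
  proof -
    \<comment> \<open>A Borel representative moves the integral from \<open>lebesgue\<close> to
      \<open>lborel\<close>, where the real case applies.\<close>
    obtain r' where r': "r' \<in> borel_measurable lborel" "AE x in lborel. r x = r' x"
      using completion_ex_borel_measurable_real[of r lborel] r by auto
    then have ae: "AE x in lebesgue. r x = r' x" by (auto intro: AE_completion)
    have meas: "r' \<in> borel_measurable lebesgue" using r'(1) by (rule measurable_completion)
    have "integrable lebesgue r'"
      using r meas ae by (subst integrable_cong_AE[symmetric]) auto
    then have "integrable lborel r'"
      using r'(1) by (simp add: integrable_completion)
    then have "AE x in lborel. r' x = 0"
    proof (rule AE_eq_0_of_fourier_real)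
      fix t
      have "(CLINT x|lborel. of_real (r' x) * iexp (t * x)) = (CLINT x|lebesgue. of_real (r' x) * iexp (t * x))"
        using r'(1) by (intro integral_completion[symmetric]) auto
      also have "\<dots> = (CLINT x|lebesgue. of_real (r x) * iexp (t * x))"
      proof (rule integral_cong_AE)
        show "(\<lambda>x. of_real (r' x) * iexp (t * x)) \<in> borel_measurable lebesgue"
          using meas by (intro borel_measurable_times iexp_meas) simp
        show "(\<lambda>x. of_real (r x) * iexp (t * x)) \<in> borel_measurable lebesgue"
          using r by (intro borel_measurable_times iexp_meas) simp
        show "AE x in lebesgue. of_real (r' x) * iexp (t * x) = of_real (r x) * iexp (t * x)"
          using ae by eventually_elim simp
      qed
      finally show "(CLINT x|lborel. of_real (r' x) * iexp (t * x)) = 0" by (simp only: z)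
    qed
    then have "AE x in lebesgue. r' x = 0" by (rule AE_completion)
    with ae show ?thesis by eventually_elim simp
  qed
  have int: "integrable lebesgue (\<lambda>x. g x * iexp (t * x))" for t
  proof (rule Bochner_Integration.integrable_bound[OF g])
    show "(\<lambda>x. g x * iexp (t * x)) \<in> borel_measurable lebesgue"
      using g by (intro borel_measurable_times iexp_meas) auto
  qed (simp add: norm_mult)
  have conj: "cnj (g x * iexp (- t * x)) = cnj (g x) * iexp (t * x)" for t x :: real
    by (simp add: exp_cnj)
  have zc: "(CLINT x|lebesgue. cnj (g x) * iexp (t * x)) = 0" for t
    using zero[of "- t"] Bochner_Integration.integral_cnj[of lebesgue "\<lambda>x. g x * iexp (- t * x)"]
    unfolding conj by (simp only: complex_cnj_zero)
  have intc: "integrable lebesgue (\<lambda>x. cnj (g x) * iexp (t * x))" for t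
    using integrable_cnj[of lebesgue "\<lambda>x. g x * iexp (- t * x)"] int[of "-t"] unfolding conj by blast
  have "AE x in lebesgue. Re (g x) = 0"
  proof (rule real)
    fix t :: real
    have "of_real (Re (g x)) * iexp (t * x) = (g x * iexp (t * x) + cnj (g x) * iexp (t * x)) / 2" for x
      unfolding distrib_right[symmetric] complex_add_cnj by simp
    then have "(CLINT x|lebesgue. of_real (Re (g x)) * iexp (t * x)) =
        ((CLINT x|lebesgue. g x * iexp (t * x)) + (CLINT x|lebesgue. cnj (g x) * iexp (t * x))) / 2"
      unfolding Bochner_Integration.integral_add[OF int intc, symmetric] by (simp only: integral_divide_zero)
    then show "(CLINT x|lebesgue. of_real (Re (g x)) * iexp (t * x)) = 0"
      by (simp only: zero zc) simp
  qed (use g in auto)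
  moreover have "AE x in lebesgue. Im (g x) = 0"
  proof (rule real)
    fix t :: real
    have "of_real (Im (g x)) = (g x - cnj (g x)) / (2 * \<i>)" for x
      by (simp add: complex_eq_iff)
    then have "of_real (Im (g x)) * iexp (t * x) = (g x * iexp (t * x) - cnj (g x) * iexp (t * x)) / (2 * \<i>)" for x
      by (simp only: left_diff_distrib[symmetric] times_divide_eq_left)
    then have "(CLINT x|lebesgue. of_real (Im (g x)) * iexp (t * x)) =
        ((CLINT x|lebesgue. g x * iexp (t * x)) - (CLINT x|lebesgue. cnj (g x) * iexp (t * x))) / (2 * \<i>)"
      unfolding Bochner_Integration.integral_diff[OF int intc, symmetric] by (simp only: integral_divide_zero)
    then show "(CLINT x|lebesgue. of_real (Im (g x)) * iexp (t * x)) = 0"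
      by (simp only: zero zc) simp
  qed (use g in auto)
  ultimately show ?thesis
    by eventually_elim (simp add: complex_eq_iff)
qed

section \<open>The Bargmann transform\<close>

text \<open>The Bargmann transform without its factor \<open>exp (- pi / 2 * z\<^sup>2)\<close>.\<close>

definition gauss_laplace :: "(real \<Rightarrow> complex) \<Rightarrow> complex \<Rightarrow> complex" where
  "gauss_laplace f z = (LINT x|lebesgue. f x * of_real (gauss x) * exp (of_real (2 * pi * x) * z))"

text \<open>Expanding \<open>(x - t)^2\<close> splits off \<open>gauss t\<close>; the modulation
  becomes the imaginary part of the Laplace variable, with a minus sign.\<close>

lemma gabor_transform_eq:
  "gabor_transform f t \<omega> = of_real (gauss t) * gauss_laplace f (of_real t - \<i> * of_real \<omega>)"
proof -
  have "f x * of_real (gauss (x - t)) * exp (- 2 * pi * \<i> * x * \<omega>) =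
      of_real (gauss t) * (f x * of_real (gauss x) * exp (of_real (2 * pi * x) * (of_real t - \<i> * of_real \<omega>)))" for x
    by (simp add: gauss_def power2_eq_square algebra_simps flip: exp_of_real exp_add)
  then show ?thesis
    unfolding gabor_transform_def gauss_laplace_def by (simp only: integral_mult_right_zero)
qed

section \<open>Gaussian integrals and integrable majorants\<close>

lemma gaussian_integral:
  assumes "p > 0"
  shows "integrable lebesgue (\<lambda>x. exp (- p * (x - r)\<^sup>2))"
    and "(LINT x|lebesgue. exp (- p * (x - r)\<^sup>2)) = sqrt (pi / p)"
proof -
  have eq: "exp (- p * (x - r)\<^sup>2) = sqrt (pi / p) * normal_density r (1 / sqrt (2 * p)) x" for x
    using assms by (simp add: normal_density_def power_divide real_sqrt_divide real_sqrt_mult field_simps)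
  show "integrable lebesgue (\<lambda>x. exp (- p * (x - r)\<^sup>2))"
    unfolding eq using assms by (subst integrable_completion) auto
  show "(LINT x|lebesgue. exp (- p * (x - r)\<^sup>2)) = sqrt (pi / p)"
    unfolding eq using assms by (subst integral_completion) auto
qed

lemma gaussian_linear_integrable:
  fixes p q :: real
  assumes "p > 0"
  shows "integrable lebesgue (\<lambda>x. exp (- p * x\<^sup>2 + q * \<bar>x\<bar>))"
proof -
  have int: "integrable lebesgue (\<lambda>x. exp (- p * x\<^sup>2 + s * x))" for s
  proof -
    have *: "- p * x\<^sup>2 + s * x = s\<^sup>2 / (4 * p) + - p * (x - s / (2 * p))\<^sup>2" for x
      using assms by (simp add: power2_eq_square field_simps)
    have "exp (- p * x\<^sup>2 + s * x) = exp (s\<^sup>2 / (4 * p)) * exp (- p * (x - s / (2 * p))\<^sup>2)" for x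
      unfolding * exp_add ..
    then show ?thesis
      using gaussian_integral(1)[OF assms] by simp
  qed
  show ?thesis
  proof (rule Bochner_Integration.integrable_bound)
    show "integrable lebesgue (\<lambda>x. exp (- p * x\<^sup>2 + q * x) + exp (- p * x\<^sup>2 + - q * x))"
      by (intro Bochner_Integration.integrable_add int)
    show "AE x in lebesgue. norm (exp (- p * x\<^sup>2 + q * \<bar>x\<bar>)) \<le> norm (exp (- p * x\<^sup>2 + q * x) + exp (- p * x\<^sup>2 + - q * x))"
    proof (intro AE_I2)
      fix x :: real
      have "\<bar>x\<bar> = x \<or> \<bar>x\<bar> = - x" by linarith
      then have "exp (- p * x\<^sup>2 + q * \<bar>x\<bar>) = exp (- p * x\<^sup>2 + q * x) \<or>
          exp (- p * x\<^sup>2 + q * \<bar>x\<bar>) = exp (- p * x\<^sup>2 + - q * x)" by auto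
      then show "norm (exp (- p * x\<^sup>2 + q * \<bar>x\<bar>)) \<le> norm (exp (- p * x\<^sup>2 + q * x) + exp (- p * x\<^sup>2 + - q * x))"
        using exp_gt_zero[of "- p * x\<^sup>2 + q * x"] exp_gt_zero[of "- p * x\<^sup>2 + - q * x"]
        unfolding real_norm_def by linarith
    qed
  qed (intro measurable_completion; simp)
qed

text \<open>Replaces Cauchy-Schwarz: products of square-integrable functions get an integrable
  bound.\<close>

lemma mult_le_sum_squares: "u * v \<le> u\<^sup>2 + v\<^sup>2" for u v :: real
  using sum_squares_bound[of u v] zero_le_power2[of u] zero_le_power2[of v] by linarith

text \<open>With \<open>q = 2 * pi * |z|\<close> this is the majorant for the Laplace kernel at
  \<open>z\<close> and for the partial sums of its exponential series.\<close>

lemma L2_gauss_integrable: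
  assumes "f \<in> L2"
  shows "integrable lebesgue (\<lambda>x. cmod (f x) * exp (- pi * x\<^sup>2 + q * \<bar>x\<bar>))"
proof (rule Bochner_Integration.integrable_bound)
  have eq: "(exp (- pi * x\<^sup>2 + q * \<bar>x\<bar>))\<^sup>2 = exp (- (2 * pi) * x\<^sup>2 + (2 * q) * \<bar>x\<bar>)" for x
    by (simp add: power2_eq_square algebra_simps flip: exp_add)
  show "integrable lebesgue (\<lambda>x. (cmod (f x))\<^sup>2 + (exp (- pi * x\<^sup>2 + q * \<bar>x\<bar>))\<^sup>2)"
    unfolding eq using assms by (intro Bochner_Integration.integrable_add gaussian_linear_integrable) (auto simp: L2_def)
  show "AE x in lebesgue. norm (cmod (f x) * exp (- pi * x\<^sup>2 + q * \<bar>x\<bar>)) \<le>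
      norm ((cmod (f x))\<^sup>2 + (exp (- pi * x\<^sup>2 + q * \<bar>x\<bar>))\<^sup>2)"
    using mult_le_sum_squares by (auto simp: abs_mult)
  have "(\<lambda>x. exp (- pi * x\<^sup>2 + q * \<bar>x\<bar>)) \<in> borel_measurable lebesgue"
    by (rule measurable_completion) simp
  then show "(\<lambda>x. cmod (f x) * exp (- pi * x\<^sup>2 + q * \<bar>x\<bar>)) \<in> borel_measurable lebesgue"
    using assms by (intro borel_measurable_times) (auto simp: L2_def)
qed

lemma norm_gauss_kernel:
  "cmod (f x * of_real (gauss x) * exp (of_real (2 * pi * x) * z)) = cmod (f x) * exp (- pi * x\<^sup>2 + 2 * pi * x * Re z)"
  by (simp add: norm_mult gauss_def mult.assoc flip: exp_add)

lemma gauss_kernel_integrable: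
  assumes "f \<in> L2"
  shows "integrable lebesgue (\<lambda>x. f x * of_real (gauss x) * exp (of_real (2 * pi * x) * z))"
proof (rule Bochner_Integration.integrable_bound[OF L2_gauss_integrable[OF assms]])
  have "(\<lambda>x. complex_of_real (gauss x) * exp (of_real (2 * pi * x) * z)) \<in> borel_measurable lebesgue"
    unfolding gauss_def by (rule measurable_completion) simp
  then show "(\<lambda>x. f x * of_real (gauss x) * exp (of_real (2 * pi * x) * z)) \<in> borel_measurable lebesgue"
    using assms borel_measurable_times[of f lebesgue] by (simp add: L2_def mult.assoc)
  have "x * Re z \<le> cmod z * \<bar>x\<bar>" for x
    using mult_mono[OF order_refl[of "\<bar>x\<bar>"] abs_Re_le_cmod[of z]] abs_ge_self[of "x * Re z"]
    by (simp add: abs_mult mult.commute)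
  from mult_left_mono[OF this, of "2 * pi"]
  show "AE x in lebesgue. norm (f x * of_real (gauss x) * exp (of_real (2 * pi * x) * z)) \<le>
      norm (cmod (f x) * exp (- pi * x\<^sup>2 + (2 * pi * cmod z) * \<bar>x\<bar>))"
    unfolding norm_gauss_kernel by (auto simp: abs_mult mult.assoc intro!: mult_left_mono)
qed

text \<open>Completing the square isolates \<open>exp (pi * r^2)\<close> with
  \<open>r = Re z\<close>; what remains is a Gaussian centred at \<open>r\<close>, whose integral
  does not depend on \<open>r\<close>.\<close>

lemma gauss_laplace_bound:
  assumes "f \<in> L2"
  obtains C where "\<And>z. cmod (gauss_laplace f z) \<le> C * exp (pi * (Re z)\<^sup>2)"
proof
  define C where "C = (LINT x|lebesgue. (cmod (f x))\<^sup>2) + sqrt (pi / (2 * pi))"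
  fix z
  define r where "r = Re z"
  have bd: "integrable lebesgue (\<lambda>x. (cmod (f x))\<^sup>2)" using assms by (simp add: L2_def)
  have pt: "cmod (f x * of_real (gauss x) * exp (of_real (2 * pi * x) * z)) \<le>
      ((cmod (f x))\<^sup>2 + exp (- (2 * pi) * (x - r)\<^sup>2)) * exp (pi * r\<^sup>2)" for x
  proof -
    have "cmod (f x * of_real (gauss x) * exp (of_real (2 * pi * x) * z)) =
        cmod (f x) * exp (- pi * (x - r)\<^sup>2) * exp (pi * r\<^sup>2)"
      unfolding norm_gauss_kernel r_def by (simp add: power2_eq_square algebra_simps flip: exp_add)
    moreover have "cmod (f x) * exp (- pi * (x - r)\<^sup>2) \<le> (cmod (f x))\<^sup>2 + (exp (- pi * (x - r)\<^sup>2))\<^sup>2"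
      by (rule mult_le_sum_squares)
    moreover have "(exp (- pi * (x - r)\<^sup>2))\<^sup>2 = exp (- (2 * pi) * (x - r)\<^sup>2)"
      by (simp add: power2_eq_square flip: exp_add)
    ultimately show ?thesis by (simp add: mult_right_mono)
  qed
  have "cmod (gauss_laplace f z) \<le> (LINT x|lebesgue. ((cmod (f x))\<^sup>2 + exp (- (2 * pi) * (x - r)\<^sup>2)) * exp (pi * r\<^sup>2))"
    unfolding gauss_laplace_def
  proof (rule Bochner_Integration.integral_norm_bound_integral)
    show "integrable lebesgue (\<lambda>x. ((cmod (f x))\<^sup>2 + exp (- (2 * pi) * (x - r)\<^sup>2)) * exp (pi * r\<^sup>2))"
      using bd gaussian_integral(1)[of "2 * pi" r] by simp
  qed (use pt gauss_kernel_integrable[OF assms] in auto)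
  also have "\<dots> = C * exp (pi * r\<^sup>2)"
    using bd gaussian_integral[of "2 * pi" r] by (simp add: C_def)
  finally show "cmod (gauss_laplace f z) \<le> C * exp (pi * (Re z)\<^sup>2)" by (simp add: r_def)
qed

text \<open>The exponential is expanded and integrated term by term under the majorant, which gives
  a power series in \<open>z\<close> that converges on the whole plane.\<close>

lemma gauss_laplace_holomorphic:
  assumes "f \<in> L2"
  shows "gauss_laplace f holomorphic_on UNIV"
proof -
  define k where "k = (\<lambda>z x n. f x * of_real (gauss x) * ((of_real (2 * pi * x) * z) ^ n /\<^sub>R fact n))"
  have meas: "(\<lambda>x. k z x n) \<in> borel_measurable lebesgue" for z n
  proof -
    have "(\<lambda>x. complex_of_real (gauss x) * ((of_real (2 * pi * x) * z) ^ n /\<^sub>R fact n)) \<in> borel_measurable lebesgue"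
      unfolding gauss_def by (rule measurable_completion) simp
    from borel_measurable_times[OF _ this, of f] show ?thesis
      using assms by (simp only: L2_def k_def mult.assoc[of "f _"] mem_Collect_eq)
  qed
  have kexp: "(\<lambda>n. norm (k z x n)) sums (cmod (f x) * exp (- pi * x\<^sup>2 + (2 * pi * cmod z) * \<bar>x\<bar>))" for z x
  proof -
    have "norm (k z x n) = (cmod (f x) * exp (- pi * x\<^sup>2)) * ((2 * pi * \<bar>x\<bar> * cmod z) ^ n /\<^sub>R fact n)" for n
      by (simp add: k_def norm_mult norm_power gauss_def abs_mult)
    moreover have "cmod (f x) * exp (- pi * x\<^sup>2 + (2 * pi * cmod z) * \<bar>x\<bar>) =
        (cmod (f x) * exp (- pi * x\<^sup>2)) * exp (2 * pi * \<bar>x\<bar> * cmod z)"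
      by (simp add: mult_ac flip: exp_add)
    ultimately show ?thesis
      using sums_mult[OF exp_converges[of "2 * pi * \<bar>x\<bar> * cmod z"]] by (simp only:)
  qed
  have int: "integrable lebesgue (\<lambda>x. k z x n)" for z n
  proof (rule Bochner_Integration.integrable_bound[OF L2_gauss_integrable[OF assms] meas])
    show "AE x in lebesgue. norm (k z x n) \<le> norm (cmod (f x) * exp (- pi * x\<^sup>2 + (2 * pi * cmod z) * \<bar>x\<bar>))"
      using sums_unique[OF kexp] sum_le_suminf[OF sums_summable[OF kexp], of "{n}"]
      by (auto intro!: AE_I2 intro: order_trans[OF _ abs_ge_self])
  qed
  have "(\<lambda>n. (LINT x|lebesgue. k 1 x n) * (z - 0) ^ n) sums gauss_laplace f z" for z
  proof -
    have "(\<lambda>N. LINT x|lebesgue. (\<Sum>n<N. k z x n)) \<longlonglongrightarrow> gauss_laplace f z"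
      unfolding gauss_laplace_def
    proof (rule integral_dominated_convergence[OF _ _ L2_gauss_integrable[OF assms]])
      show "AE x in lebesgue. (\<lambda>N. \<Sum>n<N. k z x n) \<longlonglongrightarrow> f x * of_real (gauss x) * exp (of_real (2 * pi * x) * z)"
        unfolding k_def sums_def[symmetric] by (intro AE_I2 sums_mult exp_converges)
      show "AE x in lebesgue. norm (\<Sum>n<N. k z x n) \<le> cmod (f x) * exp (- pi * x\<^sup>2 + (2 * pi * cmod z) * \<bar>x\<bar>)" for N
        using sums_unique[OF kexp] sum_le_suminf[OF sums_summable[OF kexp], of "{..<N}"]
        by (auto intro!: order_trans[OF norm_sum])
    qed (use meas gauss_kernel_integrable[OF assms] in auto)
    moreover have "k z x n = k 1 x n * z ^ n" for x n
      by (simp add: k_def power_mult_distrib)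
    ultimately show ?thesis
      unfolding sums_def using int[of 1] by simp
  qed
  then have "gauss_laplace f holomorphic_on ball 0 r" for r
    by (intro power_series_holomorphic)
  then have "gauss_laplace f field_differentiable at z" for z
    unfolding holomorphic_on_def
    by (metis at_within_open dist_0_norm gt_ex mem_ball open_ball)
  then show ?thesis by (auto simp: holomorphic_on_def)
qed

text \<open>On the imaginary axis the transform is the Fourier transform of the function times
  \<open>gauss\<close>, and \<open>gauss\<close> has no zeros.\<close>

lemma gauss_laplace_inj:
  assumes f: "f1 \<in> L2" "f2 \<in> L2"
    and eq: "\<And>z. gauss_laplace f1 z = c * gauss_laplace f2 z"
  shows "AE x in lebesgue. f1 x = c * f2 x"
proof -
  define g where "g = (\<lambda>x. (f1 x - c * f2 x) * of_real (gauss x))"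
  have ker: "g x * exp (of_real (2 * pi * x) * z) = f1 x * of_real (gauss x) * exp (of_real (2 * pi * x) * z)
      - c * (f2 x * of_real (gauss x) * exp (of_real (2 * pi * x) * z))" for x z
    by (simp add: g_def algebra_simps)
  have int: "integrable lebesgue (\<lambda>x. g x * exp (of_real (2 * pi * x) * z))" for z
    unfolding ker using gauss_kernel_integrable[OF f(1), of z] gauss_kernel_integrable[OF f(2), of z] by auto
  have "AE x in lebesgue. g x = 0"
  proof (rule AE_eq_0_of_fourier)
    show "integrable lebesgue g" using int[of 0] by simp
    fix t :: real
    have "(LINT x|lebesgue. g x * exp (of_real (2 * pi * x) * z)) = 0" for z
    proof -
      have "(LINT x|lebesgue. g x * exp (of_real (2 * pi * x) * z)) = gauss_laplace f1 z - c * gauss_laplace f2 z"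
        unfolding ker gauss_laplace_def
        by (subst Bochner_Integration.integral_diff)
           (simp_all only: integral_mult_right_zero integrable_mult_right gauss_kernel_integrable f)
      then show ?thesis using eq by simp
    qed
    from this[of "\<i> * of_real (t / (2 * pi))"]
    have "(LINT x|lebesgue. g x * exp (of_real (2 * pi * x) * (\<i> * of_real (t / (2 * pi))))) = 0" .
    moreover have "of_real (2 * pi * x) * (\<i> * of_real (t / (2 * pi))) = \<i> * complex_of_real (t * x)" for x
      by simp
    ultimately show "(CLINT x|lebesgue. g x * iexp (t * x)) = 0" by (simp only:)
  qed
  then show ?thesis
    by eventually_elim (simp add: g_def gauss_def)
qed

text \<open>The usual Bargmann transform up to the constant \<open>2 powr (1/4)\<close>. The
  quadratic factor makes the growth bound depend on \<open>|z|\<close> only, so that it survives a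
  quarter turn.\<close>

definition bargmann :: "(real \<Rightarrow> complex) \<Rightarrow> complex \<Rightarrow> complex" where
  "bargmann f z = exp (- of_real (pi / 2) * z\<^sup>2) * gauss_laplace f z"

lemma norm_bargmann:
  "cmod (bargmann f z) = exp (- (pi / 2) * ((Re z)\<^sup>2 - (Im z)\<^sup>2)) * cmod (gauss_laplace f z)"
  by (simp add: bargmann_def norm_mult norm_exp_eq_Re Re_power2)

lemma norm_gabor_transform:
  "cmod (gabor_transform f t \<omega>) = exp (- (pi / 2) * (t\<^sup>2 + \<omega>\<^sup>2)) * cmod (bargmann f (Complex t (- \<omega>)))"
proof -
  have "of_real t - \<i> * of_real \<omega> = Complex t (- \<omega>)" by (simp add: complex_eq_iff)
  then show ?thesis
    unfolding gabor_transform_eq norm_bargmann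
    by (simp add: norm_mult gauss_def algebra_simps flip: exp_add)
qed

lemma bargmann_holomorphic:
  assumes "f \<in> L2"
  shows "bargmann f holomorphic_on UNIV"
  unfolding bargmann_def using gauss_laplace_holomorphic[OF assms] by (intro holomorphic_intros)

lemma bargmann_bound:
  assumes "f \<in> L2"
  obtains C where "\<And>z. cmod (bargmann f z) \<le> C * exp (pi / 2 * (cmod z)\<^sup>2)"
proof -
  obtain C where C: "\<And>z. cmod (gauss_laplace f z) \<le> C * exp (pi * (Re z)\<^sup>2)"
    using gauss_laplace_bound[OF assms] by blast
  have "cmod (bargmann f z) \<le> C * exp (pi / 2 * (cmod z)\<^sup>2)" for z
  proof -
    have "cmod (bargmann f z) \<le> exp (- (pi / 2) * ((Re z)\<^sup>2 - (Im z)\<^sup>2)) * (C * exp (pi * (Re z)\<^sup>2))"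
      unfolding norm_bargmann using C by (intro mult_left_mono) auto
    also have "\<dots> = C * exp (pi / 2 * (cmod z)\<^sup>2)"
      unfolding cmod_power2 by (simp add: algebra_simps flip: exp_add)
    finally show ?thesis .
  qed
  then show ?thesis by (rule that)
qed

lemma bargmann_inj:
  assumes "f1 \<in> L2" "f2 \<in> L2" "\<And>z. bargmann f1 z = c * bargmann f2 z"
  shows "AE x in lebesgue. f1 x = c * f2 x"
  using assms by (intro gauss_laplace_inj) (auto simp: bargmann_def)

section \<open>Gabor phase retrieval\<close>

lemma gabor_phase_retrieval_sqrt_lattice:
  fixes a b :: real
  assumes ab: "a > 0" "b > 0" and small: "a < 1 \<or> b < 1"
  shows "does_gabor_phase_retrieval (((*) a ` sqrt_ints) \<times> ((*) b ` sqrt_ints))"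
  unfolding does_gabor_phase_retrieval_def
proof (intro ballI impI)
  fix f1 f2 assume f: "f1 \<in> L2" "f2 \<in> L2"
    and eq: "\<forall>(t, \<omega>)\<in>((*) a ` sqrt_ints) \<times> ((*) b ` sqrt_ints).
               cmod (gabor_transform f1 t \<omega>) = cmod (gabor_transform f2 t \<omega>)"
  have lattice: "a * sqrt (real n) \<in> (*) a ` sqrt_ints" "a * - sqrt (real n) \<in> (*) a ` sqrt_ints" for n a
    by (intro imageI; auto simp: sqrt_ints_def)+
  have bargmann_eq: "cmod (bargmann f1 (Complex t (- \<omega>))) = cmod (bargmann f2 (Complex t (- \<omega>)))"
    if "t \<in> (*) a ` sqrt_ints" "\<omega> \<in> (*) b ` sqrt_ints" for t \<omega>
    using eq that by (auto simp: norm_gabor_transform)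
  obtain C1 C2 where C: "\<And>z. cmod (bargmann f1 z) \<le> C1 * exp (pi / 2 * (cmod z)\<^sup>2)"
      "\<And>z. cmod (bargmann f2 z) \<le> C2 * exp (pi / 2 * (cmod z)\<^sup>2)"
    using bargmann_bound[OF f(1)] bargmann_bound[OF f(2)] by metis
  note hol = bargmann_holomorphic[OF f(1)] bargmann_holomorphic[OF f(2)]
  have "\<exists>c. cmod c = 1 \<and> (\<forall>z. bargmann f1 z = c * bargmann f2 z)"
  proof (cases "a < 1")
    case True
    show ?thesis
    proof (rule entire_eq_up_to_phase[OF hol C _ ab(1) True ab(2)])
      show "cmod (bargmann f1 (Complex (a * sqrt (real m)) (b * sqrt (real n)))) =
            cmod (bargmann f2 (Complex (a * sqrt (real m)) (b * sqrt (real n))))" for m n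
        \<comment> \<open>The negative root as frequency compensates the sign in
          \<open>Complex t (- \<omega>)\<close>.\<close>
        using bargmann_eq[OF lattice(1) lattice(2), of m n] by simp
    qed
  next
    case False
    with small have b: "b < 1" by simp
    have rot: "(\<lambda>z. g (\<i> * z)) holomorphic_on UNIV" if "g holomorphic_on UNIV" for g
    proof -
      have "(\<lambda>z. \<i> * z) holomorphic_on UNIV" by (intro holomorphic_intros)
      from holomorphic_on_compose_gen[OF this that] show ?thesis by (simp add: o_def)
    qed
    \<comment> \<open>Multiplication by \<open>\<i>\<close> exchanges the axes and with them the
      roles of \<open>a\<close> and \<open>b\<close>; the signs that arise are absorbed by the
      symmetry of \<open>sqrt_ints\<close>.\<close>
    have "\<exists>c. cmod c = 1 \<and> (\<forall>z. bargmann f1 (\<i> * z) = c * bargmann f2 (\<i> * z))"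
    proof (rule entire_eq_up_to_phase[OF rot[OF hol(1)] rot[OF hol(2)] _ _ _ ab(2) b ab(1)])
      show "cmod (bargmann f1 (\<i> * z)) \<le> C1 * exp (pi / 2 * (cmod z)\<^sup>2)"
           "cmod (bargmann f2 (\<i> * z)) \<le> C2 * exp (pi / 2 * (cmod z)\<^sup>2)" for z
        using C[of "\<i> * z"] by (simp_all add: norm_mult)
      show "cmod (bargmann f1 (\<i> * Complex (b * sqrt (real m)) (a * sqrt (real n)))) =
            cmod (bargmann f2 (\<i> * Complex (b * sqrt (real m)) (a * sqrt (real n))))" for m n
      proof -
        have "\<i> * Complex (b * sqrt (real m)) (a * sqrt (real n)) = Complex (a * - sqrt (real n)) (- (b * - sqrt (real m)))"
          by (simp add: complex_eq_iff)
        then show ?thesis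
          using bargmann_eq[OF lattice(2) lattice(2), of n m] by simp
      qed
    qed
    then obtain c where "cmod c = 1" and c: "\<And>z. bargmann f1 (\<i> * z) = c * bargmann f2 (\<i> * z)" by blast
    moreover have "bargmann f1 z = c * bargmann f2 z" for z
      using c[of "- \<i> * z"] by simp
    ultimately show ?thesis by blast
  qed
  then obtain c where c: "cmod c = 1" "\<And>z. bargmann f1 z = c * bargmann f2 z" by blast
  have "exp (\<i> * of_real (Arg c)) = c"
    using c(1) complex_norm_eq_1_exp_eq by blast
  then show "\<exists>\<alpha>::real. AE x in lebesgue. f1 x = exp (\<i> * \<alpha>) * f2 x"
    using bargmann_inj[OF f c(2)] by metis
qed

section \<open>Chirped Gaussians and the counterexample for \<open>a = b > 1\<close>\<close>

lemma gaussian_in_L2: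
  assumes "Re l > 0"
  shows "(\<lambda>x. exp (- l * (of_real x)\<^sup>2)) \<in> L2"
proof -
  have "(cmod (exp (- l * (of_real x)\<^sup>2)))\<^sup>2 = exp (- (2 * Re l) * (x - 0)\<^sup>2)" for x :: real
    by (simp add: norm_exp_eq_Re Re_power2 Im_power2 power2_eq_square[of "exp _"] flip: exp_add)
  moreover have "(\<lambda>x::real. exp (- l * (of_real x)\<^sup>2)) \<in> borel_measurable lebesgue"
    by (rule measurable_completion) simp
  ultimately show ?thesis
    using gaussian_integral(1)[of "2 * Re l" 0] assms by (simp add: L2_def)
qed

lemma L2_add_mult:
  assumes "f \<in> L2" "g \<in> L2"
  shows "(\<lambda>x. f x + c * g x) \<in> L2"
proof -
  have meas: "(\<lambda>x. f x + c * g x) \<in> borel_measurable lebesgue"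
    using assms by (auto simp: L2_def)
  have "integrable lebesgue (\<lambda>x. (cmod (f x + c * g x))\<^sup>2)"
  proof (rule Bochner_Integration.integrable_bound)
    show "integrable lebesgue (\<lambda>x. 2 * (cmod (f x))\<^sup>2 + 2 * (cmod c)\<^sup>2 * (cmod (g x))\<^sup>2)"
      using assms by (auto simp: L2_def)
    have "(cmod (f x + c * g x))\<^sup>2 \<le> 2 * (cmod (f x))\<^sup>2 + 2 * (cmod c)\<^sup>2 * (cmod (g x))\<^sup>2" for x
    proof -
      have "(cmod (f x + c * g x))\<^sup>2 \<le> (cmod (f x) + cmod c * cmod (g x))\<^sup>2"
        using norm_triangle_ineq[of "f x" "c * g x"] by (intro power_mono) (auto simp: norm_mult)
      also have "\<dots> \<le> 2 * (cmod (f x))\<^sup>2 + 2 * (cmod c * cmod (g x))\<^sup>2"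
        using sum_squares_bound[of "cmod (f x)" "cmod c * cmod (g x)"] by (simp add: power2_sum)
      finally show ?thesis by (simp add: power_mult_distrib)
    qed
    then show "AE x in lebesgue. norm ((cmod (f x + c * g x))\<^sup>2) \<le> norm (2 * (cmod (f x))\<^sup>2 + 2 * (cmod c)\<^sup>2 * (cmod (g x))\<^sup>2)"
      by (intro AE_I2) (auto intro: order_trans[OF _ abs_ge_self])
  qed (use meas in auto)
  with meas show ?thesis by (simp add: L2_def)
qed

lemma gauss_laplace_add_mult:
  assumes "f \<in> L2" "g \<in> L2"
  shows "gauss_laplace (\<lambda>x. f x + c * g x) z = gauss_laplace f z + c * gauss_laplace g z"
proof -
  have "gauss_laplace (\<lambda>x. f x + c * g x) z =
      (LINT x|lebesgue. f x * of_real (gauss x) * exp (of_real (2 * pi * x) * z) +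
         c * (g x * of_real (gauss x) * exp (of_real (2 * pi * x) * z)))"
    unfolding gauss_laplace_def by (simp only: distrib_right mult.assoc)
  also have "\<dots> = gauss_laplace f z + c * gauss_laplace g z"
    unfolding gauss_laplace_def
    by (subst Bochner_Integration.integral_add)
       (simp_all only: integral_mult_right_zero integrable_mult_right gauss_kernel_integrable assms)
  finally show ?thesis .
qed

text \<open>Completing the square centres the Gaussian at the complex point
  \<open>w = pi * z / \<mu>\<close>. Instead of a contour shift, \<open>w\<close> is first taken
  real and the identity theorem does the rest.\<close>

lemma gauss_laplace_gaussian:
  assumes l: "Re l > 0" and \<mu>: "\<mu> = l + of_real pi"
  shows "gauss_laplace (\<lambda>x. exp (- l * (of_real x)\<^sup>2)) z =
    (LINT x|lebesgue. exp (- \<mu> * (of_real x)\<^sup>2)) * exp ((of_real pi)\<^sup>2 / \<mu> * z\<^sup>2)"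
proof -
  define K where "K = (LINT x|lebesgue. exp (- \<mu> * (of_real x)\<^sup>2))"
  define G where "G = gauss_laplace (\<lambda>x. exp (- l * (of_real x)\<^sup>2))"
  have "Re \<mu> > 0" using l pi_gt_zero by (simp add: \<mu> add_pos_pos del: pi_gt_zero)
  then have \<mu>0: "\<mu> \<noteq> 0" by auto
  have G: "G holomorphic_on UNIV"
    unfolding G_def by (intro gauss_laplace_holomorphic gaussian_in_L2 l)
  \<comment> \<open>For real \<open>w\<close> this is the Gaussian integral translated by \<open>w\<close>, hence constant.\<close>
  define A where "A = (\<lambda>w. exp (- \<mu> * w\<^sup>2) * G (\<mu> * w / of_real pi) - K)"
  have "(\<lambda>w. \<mu> * w / of_real pi) holomorphic_on UNIV" by (intro holomorphic_intros) auto
  from holomorphic_on_compose_gen[OF this G]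
  have holA: "A holomorphic_on UNIV"
    unfolding A_def by (intro holomorphic_intros) (auto simp: o_def)
  have zero: "A (of_real w) = 0" for w :: real
  proof -
    have lin: "of_real (2 * pi * x) * (\<mu> * of_real w / of_real pi) = 2 * \<mu> * of_real x * of_real w" for x
      by simp
    have "exp (- \<mu> * (of_real w)\<^sup>2) * (exp (- l * (of_real x)\<^sup>2) * of_real (gauss x) *
            exp (of_real (2 * pi * x) * (\<mu> * of_real w / of_real pi))) = exp (- \<mu> * (of_real (- w + 1 * x))\<^sup>2)" for x :: real
      unfolding lin by (simp add: \<mu> gauss_def power2_eq_square algebra_simps flip: exp_add exp_of_real)
    then have "exp (- \<mu> * (of_real w)\<^sup>2) * G (\<mu> * of_real w / of_real pi) =
        (LINT x|lebesgue. exp (- \<mu> * (of_real (- w + 1 * x))\<^sup>2))"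
      unfolding G_def gauss_laplace_def by (simp only: integral_mult_right_zero[symmetric])
    also have "\<dots> = K"
      unfolding K_def using lebesgue_integral_real_affine[of 1 "\<lambda>x. exp (- \<mu> * (of_real x)\<^sup>2)" "- w"] by simp
    finally show ?thesis by (simp add: A_def)
  qed
  have lim: "0 islimpt range complex_of_real"
    unfolding islimpt_sequential
  proof (intro exI conjI allI)
    show "complex_of_real (1 / real (Suc n)) \<in> range of_real - {0}" for n by (auto simp del: of_real_divide)
    have "(\<lambda>n. 1 / real (Suc n)) \<longlonglongrightarrow> 0" by real_asymp
    then show "(\<lambda>n. complex_of_real (1 / real (Suc n))) \<longlonglongrightarrow> 0"
      using tendsto_of_real[of "\<lambda>n. 1 / real (Suc n)" 0 sequentially, where 'a = complex] by simp
  qed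
  have "A (of_real pi * z / \<mu>) = 0"
    by (rule analytic_continuation[OF holA open_UNIV connected_UNIV _ _ lim]) (use zero in auto)
  then have "exp (- \<mu> * (of_real pi * z / \<mu>)\<^sup>2) * G z = K"
    using \<mu>0 by (simp add: A_def)
  moreover have "\<mu> * (of_real pi * z / \<mu>)\<^sup>2 = (of_real pi)\<^sup>2 / \<mu> * z\<^sup>2"
    using \<mu>0 by (simp add: power2_eq_square)
  ultimately have "exp (- ((of_real pi)\<^sup>2 / \<mu> * z\<^sup>2)) * G z = K"
    by simp
  then have "G z = K * exp ((of_real pi)\<^sup>2 / \<mu> * z\<^sup>2)"
    by (auto simp: exp_minus field_simps)
  then show ?thesis unfolding G_def K_def .
qed

text \<open>The squared moduli differ by four times \<open>Im (x * cnj y)\<close>.\<close>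

lemma norm_add_i_eq_norm_diff_i:
  assumes "Im (x * cnj y) = 0"
  shows "cmod (x + \<i> * y) = cmod (x - \<i> * y)"
proof -
  have "(cmod (x + \<i> * y))\<^sup>2 = (cmod (x - \<i> * y))\<^sup>2"
    using assms unfolding cmod_power2 by (simp add: power2_eq_square algebra_simps)
  then show ?thesis by (rule power2_eq_imp_eq) auto
qed

lemma AE_eq_0_imp_eq_0:
  fixes h :: "real \<Rightarrow> 'a::real_normed_vector"
  assumes cont: "continuous_on UNIV h" and ae: "AE x in lebesgue. h x = 0"
  shows "h x = 0"
proof (rule ccontr)
  assume "h x \<noteq> 0"
  have op: "open (h -` (- {0}))"
    using cont by (intro open_vimage) auto
  have "negligible (h -` (- {0}))"
    using ae op by (simp add: negligible_iff_null_sets AE_iff_null vimage_def Compl_eq)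
  with op open_not_negligible[OF op] \<open>h x \<noteq> 0\<close> show False by auto
qed

lemma not_gabor_phase_retrieval_sqrt_lattice:
  fixes a :: real
  assumes a: "a > 1"
  shows "\<not> does_gabor_phase_retrieval (((*) a ` sqrt_ints) \<times> ((*) a ` sqrt_ints))"
proof -
  \<comment> \<open>\<open>\<gamma>\<close> makes \<open>2 * \<gamma> * (t\<^sup>2 - \<omega>\<^sup>2)\<close> an integer multiple of \<open>pi\<close> on the lattice; \<open>\<mu>\<close> is chosen so
    that \<open>exp (- (\<mu> - pi) * x\<^sup>2)\<close> has Bargmann transform \<open>K * exp (\<i> * \<gamma> * z\<^sup>2)\<close>.\<close>
  define \<gamma> where "\<gamma> = pi / (2 * a\<^sup>2)"
  have a2: "a\<^sup>2 > 1" using a by simp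
  have \<gamma>: "\<gamma> > 0" "\<gamma> < pi / 2"
    using a a2 by (simp_all add: \<gamma>_def divide_less_eq)
  define \<mu> where "\<mu> = (of_real pi)\<^sup>2 / Complex (pi / 2) \<gamma>"
  have nz: "Complex (pi / 2) \<gamma> \<noteq> 0" by (simp add: complex_eq_iff)
  define l where "l = \<mu> - of_real pi"
  have \<gamma>2: "\<gamma>\<^sup>2 < (pi / 2)\<^sup>2" using \<gamma> by (intro power_strict_mono) auto
  have Re\<mu>: "Re \<mu> = pi\<^sup>2 * (pi / 2) / ((pi / 2)\<^sup>2 + \<gamma>\<^sup>2)" and Im\<mu>: "Im \<mu> = - (pi\<^sup>2 * \<gamma>) / ((pi / 2)\<^sup>2 + \<gamma>\<^sup>2)"
    by (simp_all add: \<mu>_def Re_divide Im_divide flip: of_real_power)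
  \<comment> \<open>The inequality \<open>\<gamma> < pi / 2\<close>, which comes from
    \<open>a > 1\<close>, gives \<open>Re \<mu> > pi\<close>, so that \<open>u\<close> and
    \<open>v\<close> will be square-integrable.\<close>
  have "pi * ((pi / 2)\<^sup>2 + \<gamma>\<^sup>2) < pi * ((pi / 2)\<^sup>2 + (pi / 2)\<^sup>2)"
    using \<gamma>2 by simp
  also have "\<dots> = pi\<^sup>2 * (pi / 2)" by (simp add: power2_eq_square)
  finally have "Re \<mu> > pi" unfolding Re\<mu> using \<gamma> by (subst pos_less_divide_eq) (auto intro: add_pos_pos)
  then have l: "Re l > 0" "Re (cnj l) > 0" by (simp_all add: l_def)
  have "(pi / 2)\<^sup>2 + \<gamma>\<^sup>2 > 0" using \<gamma> by (auto intro: add_pos_pos)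
  then have Iml: "Im l < 0" using \<gamma> Im\<mu> by (simp add: l_def)
  define u where "u = (\<lambda>x::real. exp (- l * (of_real x)\<^sup>2))"
  define v where "v = (\<lambda>x::real. exp (- cnj l * (of_real x)\<^sup>2))"
  have uv: "u \<in> L2" "v \<in> L2" unfolding u_def v_def
    by (rule gaussian_in_L2[OF l(1)], rule gaussian_in_L2[OF l(2)])
  define K where "K = (LINT x|lebesgue. exp (- \<mu> * (of_real x)\<^sup>2))"
  have "cnj K = (LINT x|lebesgue. cnj (exp (- \<mu> * (of_real x)\<^sup>2)))"
    unfolding K_def by (rule Bochner_Integration.integral_cnj[symmetric])
  then have cnjK: "(LINT x|lebesgue. exp (- cnj \<mu> * (of_real x)\<^sup>2)) = cnj K"
    by (simp add: exp_cnj)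
  have \<mu>_inv: "(of_real pi)\<^sup>2 / \<mu> = Complex (pi / 2) \<gamma>" "(of_real pi)\<^sup>2 / cnj \<mu> = cnj (Complex (pi / 2) \<gamma>)"
    using nz by (auto simp: \<mu>_def)
  have Lu: "gauss_laplace u z = K * exp (Complex (pi / 2) \<gamma> * z\<^sup>2)" for z
    using gauss_laplace_gaussian[OF l(1), of \<mu> z] unfolding u_def K_def \<mu>_inv by (simp add: l_def)
  have Lv: "gauss_laplace v z = cnj K * exp (cnj (Complex (pi / 2) \<gamma>) * z\<^sup>2)" for z
    using gauss_laplace_gaussian[OF l(2), of "cnj \<mu>" z] unfolding v_def cnjK \<mu>_inv by (simp add: l_def)
  \<comment> \<open>\<open>K\<close> is never \<open>0\<close>, but the case distinction saves the proof of this.\<close>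
  define \<kappa> where "\<kappa> = (if K = 0 then 1 else \<i> * K / cnj K)"
  have \<kappa>: "\<kappa> \<noteq> 0" "\<kappa> * cnj K = \<i> * K" by (auto simp: \<kappa>_def)
  define f where "f = (\<lambda>c x. u x + c * v x)"
  have f: "f c \<in> L2" for c unfolding f_def by (rule L2_add_mult[OF uv])
  have same: "cmod (gabor_transform (f \<kappa>) t \<omega>) = cmod (gabor_transform (f (- \<kappa>)) t \<omega>)"
    if "t \<in> (*) a ` sqrt_ints" "\<omega> \<in> (*) a ` sqrt_ints" for t \<omega>
  proof -
    have "\<exists>n::nat. s\<^sup>2 = a\<^sup>2 * real n" if "s \<in> (*) a ` sqrt_ints" for s
      using that by (auto simp: sqrt_ints_def power_mult_distrib)
    with that obtain m n :: nat where "t\<^sup>2 = a\<^sup>2 * real m" "\<omega>\<^sup>2 = a\<^sup>2 * real n"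
      by metis
    then have tw: "\<gamma> * (t\<^sup>2 - \<omega>\<^sup>2) * 2 = pi * of_int (int m - int n)"
      using a by (simp add: \<gamma>_def field_simps)
    define z where "z = of_real t - \<i> * of_real \<omega>"
    define X where "X = exp (Complex (pi / 2) \<gamma> * z\<^sup>2)"
    define Y where "Y = exp (cnj (Complex (pi / 2) \<gamma>) * z\<^sup>2)"
    \<comment> \<open>The exponents combine to one with imaginary part
      \<open>2 * \<gamma> * (t^2 - \<omega>^2)\<close>, an integer multiple of \<open>pi\<close> on
      the lattice, so \<open>X * cnj Y\<close> is real.\<close>
    have "X * cnj Y = exp (Complex (pi / 2) \<gamma> * (z\<^sup>2 + cnj (z\<^sup>2)))"
      unfolding X_def Y_def exp_cnj by (simp add: algebra_simps flip: exp_add)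
    also have "z\<^sup>2 + cnj (z\<^sup>2) = of_real (2 * (t\<^sup>2 - \<omega>\<^sup>2))"
      by (simp only: complex_add_cnj) (simp add: z_def Re_power2)
    also have "Im (exp (Complex (pi / 2) \<gamma> * of_real (2 * (t\<^sup>2 - \<omega>\<^sup>2)))) = 
        exp (pi / 2 * (2 * (t\<^sup>2 - \<omega>\<^sup>2))) * sin (\<gamma> * (t\<^sup>2 - \<omega>\<^sup>2) * 2)"
      by (simp add: Im_exp mult_ac)
    also have "\<dots> = 0" using sin_zero_iff_int2[of "\<gamma> * (t\<^sup>2 - \<omega>\<^sup>2) * 2"] unfolding tw
      by (metis mult.commute mult_zero_right)
    finally have "cmod (X + \<i> * Y) = cmod (X - \<i> * Y)" by (rule norm_add_i_eq_norm_diff_i)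
    \<comment> \<open>\<open>\<kappa>\<close> was chosen to turn \<open>cnj K\<close> into
      \<open>\<i> * K\<close>, so both transforms carry the common factor \<open>K\<close>.\<close>
    moreover have "gauss_laplace (f \<kappa>) z = K * (X + \<i> * Y)" "gauss_laplace (f (- \<kappa>)) z = K * (X - \<i> * Y)"
      unfolding f_def gauss_laplace_add_mult[OF uv] Lu Lv X_def[symmetric] Y_def[symmetric]
      using \<kappa>(2) by (simp_all add: mult.assoc[symmetric]) (simp_all add: algebra_simps)
    ultimately show ?thesis
      unfolding gabor_transform_eq z_def[symmetric] by (simp add: norm_mult)
  qed
  \<comment> \<open>By continuity, proportionality would hold at every point. Its instance at
    \<open>0\<close> reduces it to \<open>u = v\<close>, so \<open>u\<close> would be
    real-valued.\<close>
  have "\<not> (AE x in lebesgue. f \<kappa> x = c * f (- \<kappa>) x)" for c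
  proof
    assume "AE x in lebesgue. f \<kappa> x = c * f (- \<kappa>) x"
    then have "AE x in lebesgue. (1 - c) * u x + \<kappa> * (1 + c) * v x = 0"
      by eventually_elim (simp add: f_def algebra_simps)
    then have zero: "(1 - c) * u x + \<kappa> * (1 + c) * v x = 0" for x
      by (rule AE_eq_0_imp_eq_0[rotated]) (auto simp: u_def v_def intro!: continuous_intros)
    have z0: "\<kappa> * (1 + c) = - (1 - c)" using zero[of 0] by (simp add: u_def v_def algebra_simps)
    \<comment> \<open>At this point the phase of \<open>u\<close> is \<open>pi / 2\<close>, so
      \<open>u x\<close> is not real.\<close>
    define x where "x = sqrt (pi / (2 * - Im l))"
    have x2: "x\<^sup>2 * - Im l = pi / 2" using Iml by (simp add: x_def field_simps)
    have "(1 - c) * (u x - v x) = 0"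
      using zero[of x] unfolding z0 by (simp add: algebra_simps)
    moreover have "c \<noteq> 1" using z0 \<kappa> by auto
    ultimately have "u x = v x" by simp
    moreover have "v x = cnj (u x)" by (simp add: u_def v_def exp_cnj)
    ultimately have "Im (u x) = 0" by (simp add: complex_eq_iff)
    moreover have "Im (u x) = exp (- (Re l * x\<^sup>2)) * sin (x\<^sup>2 * - Im l)"
      by (simp add: u_def Im_exp mult_ac flip: of_real_power)
    ultimately show False unfolding x2 by simp
  qed
  then show ?thesis
    unfolding does_gabor_phase_retrieval_def using f same by blast
qed

theorem theorem1p1:
  fixes a b :: real
  assumes "a > 0" and "b > 0"
  defines "\<Lambda> \<equiv> ((*) a ` sqrt_ints) \<times> ((*) b ` sqrt_ints)"
  shows "(a < 1 \<or> b < 1 \<longrightarrow> does_gabor_phase_retrieval \<Lambda>) \<and>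
         (a = b \<and> b > 1 \<longrightarrow> \<not> does_gabor_phase_retrieval \<Lambda>)"
  using gabor_phase_retrieval_sqrt_lattice[OF assms(1,2)] not_gabor_phase_retrieval_sqrt_lattice
  unfolding \<Lambda>_def by blast

end
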